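(* Let $N \geq 1$ be an integer, let $\delta \in (0,1)$, and let $X$ be a Bernoulli random variable with parameter $\mathbb{P}_X = \Pr\{X=1\}$. Let $K$ be the number of successful trials (observations equal to $1$) in $N$ i.i.d. observations of $X$. Put $\theta = \frac{9}{8 \ln \frac{2}{\delta}}$ and, for $k = 0,1,\dots,N$, \[ \mathcal{L}(N,k,\delta) = \frac{k}{N} + \frac{3}{4}\;\frac{1 - \frac{2k}{N} - \sqrt{1 + 4\theta\, k\left(1-\frac{k}{N}\right)}}{1+\theta N}, \qquad \mathcal{U}(N,k,\delta) = \frac{k}{N} + \frac{3}{4}\;\frac{1 - \frac{2k}{N} + \sqrt{1 + 4\theta\, k\left(1-\frac{k}{N}\right)}}{1+\theta N}. \] Then \[ \Pr\left\{ \mathcal{L}(N,K,\delta) < \mathbb{P}_X < \mathcal{U}(N,K,\delta) \right\} > 1 - \delta . \]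
   Context: A Bernoulli random variable $X$ takes the value $1$ with probability $\mathbb{P}_X$ and the value $0$ otherwise; thus $K$ is binomially distributed with parameters $N$ and $\mathbb{P}_X$. Here $N$ is the sample size, $\delta$ is the confidence parameter, and $\ln$ denotes the natural logarithm.
   Formalization: The parameter P_X is assumed to lie strictly between 0 and 1; for P_X = 0 one has K = 0 and L(N,0,δ) = 0, and for P_X = 1 one has K = N and U(N,N,δ) = 1, so the strict inequalities fail there. *)

theory Defs
  imports "HOL-Probability.Probability"
begin

(* Values other than 0 and 1 are allowed on a null set only (once M is a probability space). *)
definition bernoulli_rv :: "'a measure \<Rightarrow> ('a \<Rightarrow> real) \<Rightarrow> real \<Rightarrow> bool" where
  "bernoulli_rv M X p \<longleftrightarrow>
     X \<in> borel_measurable M \<and>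
     measure M {\<omega> \<in> space M. X \<omega> = 1} = p \<and>
     measure M {\<omega> \<in> space M. X \<omega> = 0} = 1 - p"

definition iid_copies ::
  "'a measure \<Rightarrow> (nat \<Rightarrow> 'a \<Rightarrow> real) \<Rightarrow> nat \<Rightarrow> 'b measure \<Rightarrow> ('b \<Rightarrow> real) \<Rightarrow> bool" where
  "iid_copies M Y N S X \<longleftrightarrow>
     prob_space.indep_vars M (\<lambda>_. borel) Y {..<N} \<and>
     (\<forall>i<N. distr M borel (Y i) = distr S borel X)"

definition successes :: "(nat \<Rightarrow> 'a \<Rightarrow> real) \<Rightarrow> nat \<Rightarrow> 'a \<Rightarrow> nat" where
  "successes Y N \<omega> = card {i. i < N \<and> Y i \<omega> = 1}"

definition theta :: "real \<Rightarrow> real" where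
  "theta \<delta> = 9 / (8 * ln (2 / \<delta>))"

definition lower_limit :: "nat \<Rightarrow> nat \<Rightarrow> real \<Rightarrow> real" where
  "lower_limit N k \<delta> = real k / real N +
     3 / 4 * ((1 - 2 * real k / real N - sqrt (1 + 4 * theta \<delta> * real k * (1 - real k / real N)))
              / (1 + theta \<delta> * real N))"

definition upper_limit :: "nat \<Rightarrow> nat \<Rightarrow> real \<Rightarrow> real" where
  "upper_limit N k \<delta> = real k / real N +
     3 / 4 * ((1 - 2 * real k / real N + sqrt (1 + 4 * theta \<delta> * real k * (1 - real k / real N)))
              / (1 + theta \<delta> * real N))"

end

theory Submission
  imports Defs
begin

text \<open>
  Write \<open>x = K / N\<close>, \<open>m = (2 * p + x) / 3\<close> and \<open>l = ln (2 / \<delta>)\<close>. The two limits are the roots, as a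
  quadratic in \<open>p\<close>, of \<open>N * (x - p)\<^sup>2 = 2 * l * m * (1 - m)\<close>, so \<open>p\<close> lies strictly between them as
  soon as \<open>N * (x - p)\<^sup>2 < 2 * l * m * (1 - m)\<close> (\<open>between_limits_if_small_deviation\<close>). It remains
  to see that the opposite inequality has probability less than \<open>\<delta> / 2 = exp (- l)\<close> on each side
  \<open>x > p\<close> and \<open>x < p\<close>.

  The analytic core is Massart's bound \<open>bernoulli_kl_lower_bound\<close>: the relative entropy of a
  Bernoulli law with parameter \<open>x\<close> with respect to one with parameter \<open>p\<close> exceeds
  \<open>(x - p)\<^sup>2 / (2 * m * (1 - m))\<close> whenever \<open>p < x\<close>. Indeed, this entropy is the integral over \<open>t\<close> from \<open>p\<close>
  to \<open>x\<close> of \<open>(x - t) / (t * (1 - t))\<close>; the weight \<open>x - t\<close> has total mass \<open>(x - p)\<^sup>2 / 2\<close> and mean \<open>m\<close>,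
  and \<open>1 / (t * (1 - t))\<close> is strictly convex, so Jensen's inequality applies.

  For the side \<open>x > p\<close>, let \<open>k0\<close> be the least count that deviates too far. The bad event implies
  \<open>K \<ge> k0\<close>, and the Chernoff bound at \<open>k0\<close> together with Massart's bound at \<open>k0 / N\<close> gives a
  probability less than \<open>exp (- l)\<close>; no monotonicity of the deviation in \<open>x\<close> is needed. The strict
  inequality in the conclusion comes from the strictness of Massart's bound. The side \<open>x < p\<close>
  follows by exchanging successes and failures.
\<close>

section \<open>Relative entropy of Bernoulli distributions\<close>

text \<open>
  The Kullback-Leibler divergence of the Bernoulli distribution with parameter \<open>x\<close> from the one
  with parameter \<open>p\<close>. At \<open>x = 0\<close> and \<open>x = 1\<close> the logarithm of zero is multiplied by zero, so
  these boundary values are the usual ones.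
\<close>

definition bernoulli_kl :: "real \<Rightarrow> real \<Rightarrow> real" where
  "bernoulli_kl x p = x * (ln x - ln p) + (1 - x) * (ln (1 - x) - ln (1 - p))"

text \<open>
  Strict convexity of \<open>1 / (t * (1 - t))\<close> on the open unit interval, as the tangent line inequality
  at the point \<open>m\<close>.
\<close>

lemma inverse_variance_above_tangent:
  fixes m t :: real
  assumes m: "0 < m" "m < 1" and t: "0 < t" "t < 1" and "t \<noteq> m"
  shows "1 / (m * (1 - m)) + (2 * m - 1) / (m * (1 - m))\<^sup>2 * (t - m) < 1 / (t * (1 - t))"
proof -
  define v w where "v = m * (1 - m)" and "w = t * (1 - t)"
  have v: "v > 0" and w: "w > 0" using m t by (simp_all add: v_def w_def)
  have "(t - m)\<^sup>2 * ((1 - t) * (1 - m)\<^sup>2 + t * m\<^sup>2) > 0"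
    using assms by (intro mult_pos_pos add_pos_pos) auto
  also have "(t - m)\<^sup>2 * ((1 - t) * (1 - m)\<^sup>2 + t * m\<^sup>2) = v\<^sup>2 - w * (v + (2 * m - 1) * (t - m))"
    unfolding v_def w_def by algebra
  finally have "w * (v + (2 * m - 1) * (t - m)) < v\<^sup>2" by simp
  moreover have "1 / v + (2 * m - 1) / v\<^sup>2 * (t - m) = (v + (2 * m - 1) * (t - m)) / v\<^sup>2"
    using v by (simp add: field_simps power2_eq_square)
  ultimately have "1 / v + (2 * m - 1) / v\<^sup>2 * (t - m) < 1 / w"
    using v w by (simp add: pos_divide_less_eq pos_less_divide_eq mult.commute)
  then show ?thesis by (simp add: v_def w_def)
qed

text \<open>
  Massart's inequality. The tangent line inequality at \<open>m\<close> is integrated against the weight \<open>x - t\<close>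
  in differential form: \<open>H\<close> is the integral of the weighted tangent line from \<open>t\<close> to \<open>x\<close>, and
  \<open>bernoulli_kl x t - H t\<close> decreases in \<open>t\<close> to its value \<open>0\<close> at \<open>t = x\<close>.
\<close>

lemma bernoulli_kl_lower_bound:
  fixes x p :: real
  assumes p: "0 < p" and px: "p < x" and x: "x \<le> 1"
  defines "m \<equiv> (2 * p + x) / 3"
  shows "(x - p)\<^sup>2 / (2 * (m * (1 - m))) < bernoulli_kl x p"
proof -
  define A B where "A = 1 / (m * (1 - m))" and "B = (2 * m - 1) / (m * (1 - m))\<^sup>2"
  define H where "H t = (x - t)\<^sup>2 / 2 * (A + B * (t + (x - t) / 3 - m))" for t
  define G where "G t = bernoulli_kl x t - H t" for t
  have m: "p < m" "m < x" using px by (simp_all add: m_def)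
  have dG: "(G has_real_derivative - (x - t) * (1 / (t * (1 - t)) - (A + B * (t - m)))) (at t)"
    if "p < t" "t < x" for t
  proof -
    have t: "0 < t" "t < 1" using that p x by auto
    have "(H has_real_derivative - (x - t) * (A + B * (t - m))) (at t)"
      unfolding H_def by (auto intro!: derivative_eq_intros simp: field_simps power2_eq_square)
    moreover have "(bernoulli_kl x has_real_derivative - (x / t) + (1 - x) / (1 - t)) (at t)"
      unfolding bernoulli_kl_def[abs_def] using t by (auto intro!: derivative_eq_intros)
    moreover have "- (x / t) + (1 - x) / (1 - t) = - (x - t) * (1 / (t * (1 - t)))"
      using t by (simp add: divide_simps) algebra
    ultimately show ?thesis
      unfolding G_def[abs_def] by (auto intro!: derivative_eq_intros simp: algebra_simps)
  qed
  have cont: "continuous_on {p..x} G"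
  proof -
    \<comment> \<open>For \<open>x = 1\<close> the factor \<open>ln (1 - t)\<close> is singular at the right end, but its coefficient is zero.\<close>
    have "continuous_on {p..x} (\<lambda>t. (1 - x) * (ln (1 - x) - ln (1 - t)))"
      using x by (cases "x = 1") (auto intro!: continuous_intros)
    then have "continuous_on {p..x} (bernoulli_kl x)"
      unfolding bernoulli_kl_def[abs_def] using p
      by (intro continuous_on_add) (auto intro!: continuous_intros)
    then show ?thesis
      unfolding G_def[abs_def] H_def by (intro continuous_intros) auto
  qed
  have dec: "G b < G a" if ab: "p \<le> a" "a < b" "b \<le> x" "m \<notin> {a<..<b}" for a b
  proof (rule DERIV_neg_imp_decreasing_open[OF ab(2)])
    show "continuous_on {a..b} G" using ab by (intro continuous_on_subset[OF cont]) auto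
    fix t assume t: "a < t" "t < b"
    have "A + B * (t - m) < 1 / (t * (1 - t))"
      unfolding A_def B_def
      by (rule inverse_variance_above_tangent) (use t ab m p x in auto)
    then have "- (x - t) * (1 / (t * (1 - t)) - (A + B * (t - m))) < 0"
      using t ab by (intro mult_neg_pos) auto
    with dG[of t] t ab show "\<exists>y. (G has_real_derivative y) (at t) \<and> y < 0" by auto
  qed
  \<comment> \<open>The derivative of \<open>G\<close> vanishes at \<open>m\<close>, so the interval is split there.\<close>
  have "G x = 0" by (simp add: G_def H_def bernoulli_kl_def)
  moreover have "G x < G m" "G m < G p" using m by (auto intro!: dec)
  ultimately have "H p < bernoulli_kl x p" by (simp add: G_def)
  \<comment> \<open>As \<open>m\<close> is the mean of the weight on the whole interval, the slope \<open>B\<close> drops out of \<open>H p\<close>.\<close>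
  moreover have "p + (x - p) / 3 - m = 0" by (simp add: m_def field_simps)
  then have "H p = (x - p)\<^sup>2 / (2 * (m * (1 - m)))" by (simp add: H_def A_def)
  ultimately show ?thesis by simp
qed

section \<open>Tails of the binomial distribution\<close>

lemma measure_binomial_pmf:
  assumes "p \<in> {0..1}"
  shows "measure_pmf.prob (binomial_pmf n p) A =
    (\<Sum>k\<in>A \<inter> {..n}. real (n choose k) * p ^ k * (1 - p) ^ (n - k))"
proof -
  have "measure_pmf.prob (binomial_pmf n p) A = measure_pmf.prob (binomial_pmf n p) (A \<inter> {..n})"
    using assms by (intro measure_prob_cong_0) (auto simp: set_pmf_binomial_eq binomial_eq_0)
  then show ?thesis
    using assms by (simp add: measure_measure_pmf_finite)
qed

lemma prob_binomial_pmf_reflect: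
  assumes p: "p \<in> {0..1}"
  shows "measure_pmf.prob (binomial_pmf n p) A =
    measure_pmf.prob (binomial_pmf n (1 - p)) {k. k \<le> n \<and> n - k \<in> A}"
proof -
  have "(\<Sum>k\<in>A \<inter> {..n}. real (n choose k) * p ^ k * (1 - p) ^ (n - k)) =
    (\<Sum>k\<in>{k. k \<le> n \<and> n - k \<in> A} \<inter> {..n}.
       real (n choose k) * (1 - p) ^ k * (1 - (1 - p)) ^ (n - k))"
    by (rule sum.reindex_bij_witness[of _ "\<lambda>k. n - k" "\<lambda>k. n - k"])
       (auto simp: binomial_symmetric[symmetric])
  then show ?thesis using p by (simp add: measure_binomial_pmf)
qed

text \<open>
  The Chernoff bound by change of measure: on \<open>k \<ge> k0\<close> the likelihood ratio of the binomial laws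
  with parameters \<open>p\<close> and \<open>k0 / n\<close> is at most its value at \<open>k0\<close>. Kept in multiplied-out form, the
  comparison also covers \<open>k0 = n\<close>, where the second parameter is \<open>1\<close>.
\<close>

lemma binomial_pmf_chernoff:
  assumes p: "0 < p" "p < 1" and "0 < n" and k0: "k0 \<le> n" and px: "p \<le> real k0 / real n"
  shows "measure_pmf.prob (binomial_pmf n p) {k0..}
    \<le> exp (- real n * bernoulli_kl (real k0 / real n) p)"
proof -
  define x where "x = real k0 / real n"
  have x: "0 < x" "x \<le> 1" "p \<le> x" using assms by (auto simp: x_def)
  have nx: "real n * x = real k0" "real n * (1 - x) = real (n - k0)"
    using assms by (auto simp: x_def field_simps of_nat_diff)
  define Z where "Z = x ^ k0 * (1 - x) ^ (n - k0)"
  have Z: "Z > 0"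
  proof (cases "k0 = n")
    case False
    then have "x < 1" using assms by (simp add: x_def)
    then show ?thesis using x by (simp add: Z_def)
  qed (use x in \<open>simp add: Z_def\<close>)
  have termwise: "p ^ k * (1 - p) ^ (n - k) * Z
      \<le> x ^ k * (1 - x) ^ (n - k) * (p ^ k0 * (1 - p) ^ (n - k0))"
    if k: "k0 \<le> k" "k \<le> n" for k
  proof -
    obtain d where d: "k = k0 + d" using k(1) le_Suc_ex by blast
    obtain e where e: "n = k0 + d + e" using k(2) le_Suc_ex d by blast
    have "p * (1 - x) \<le> x * (1 - p)" using x by (simp add: algebra_simps)
    then have "(p * (1 - x)) ^ d \<le> (x * (1 - p)) ^ d"
      using p x by (intro power_mono) auto
    then have "((p * x) ^ k0 * ((1 - p) * (1 - x)) ^ e) * (p * (1 - x)) ^ d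
        \<le> ((p * x) ^ k0 * ((1 - p) * (1 - x)) ^ e) * (x * (1 - p)) ^ d"
      using p x by (intro mult_left_mono) auto
    then show ?thesis
      by (simp add: Z_def d e power_add power_mult_distrib mult_ac)
  qed
  have "measure_pmf.prob (binomial_pmf n p) {k0..} * Z =
      (\<Sum>k\<in>{k0..} \<inter> {..n}. real (n choose k) * (p ^ k * (1 - p) ^ (n - k) * Z))"
    using p by (simp add: measure_binomial_pmf sum_distrib_right) (simp add: mult_ac)
  also have "\<dots> \<le> (\<Sum>k\<in>{k0..} \<inter> {..n}.
      real (n choose k) * (x ^ k * (1 - x) ^ (n - k) * (p ^ k0 * (1 - p) ^ (n - k0))))"
    by (intro sum_mono mult_left_mono termwise) auto
  also have "\<dots> = measure_pmf.prob (binomial_pmf n x) {k0..} * (p ^ k0 * (1 - p) ^ (n - k0))"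
    using x by (simp add: measure_binomial_pmf sum_distrib_right) (simp add: mult_ac)
  also have "\<dots> \<le> 1 * (p ^ k0 * (1 - p) ^ (n - k0))"
    using p by (intro mult_right_mono) auto
  finally have "measure_pmf.prob (binomial_pmf n p) {k0..} \<le> p ^ k0 * (1 - p) ^ (n - k0) / Z"
    using Z by (simp add: field_simps)
  also have "\<dots> = exp (ln (p ^ k0 * (1 - p) ^ (n - k0) / Z))"
    using Z p by simp
  also have "ln (p ^ k0 * (1 - p) ^ (n - k0) / Z) =
      real k0 * (ln p - ln x) + real (n - k0) * (ln (1 - p) - ln (1 - x))"
  proof -
    have "ln Z = real k0 * ln x + real (n - k0) * ln (1 - x)"
      using Z x unfolding Z_def by (subst ln_mult_pos) (auto simp: ln_realpow zero_less_mult_iff)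
    then show ?thesis
      using Z p by (simp add: ln_div ln_mult_pos ln_realpow algebra_simps)
  qed
  also have "\<dots> = - real n * bernoulli_kl x p"
    unfolding bernoulli_kl_def nx[symmetric] by algebra
  finally show ?thesis by (simp add: x_def)
qed

text \<open>
  Chernoff's and Massart's bounds, both applied at the least count \<open>k0\<close> in the deviation set.
\<close>

lemma binomial_pmf_upper_deviation:
  fixes p c :: real
  assumes p: "0 < p" "p < 1" and n: "0 < n" and c: "0 < c"
  shows "measure_pmf.prob (binomial_pmf n p)
    {k. k \<le> n \<and> p < real k / real n \<and>
        2 * c * ((2 * p + real k / real n) / 3 * (1 - (2 * p + real k / real n) / 3))
          \<le> real n * (real k / real n - p)\<^sup>2} < exp (- c)"
    (is "measure_pmf.prob _ ?U < _")
proof (cases "?U = {}")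
  case False
  define k0 where "k0 = (LEAST k. k \<in> ?U)"
  from False obtain k where "k \<in> ?U" by blast
  then have k0: "k0 \<in> ?U" unfolding k0_def by (rule LeastI)
  have sub: "?U \<subseteq> {k0..}" unfolding k0_def by (intro subsetI) (simp only: atLeast_iff Least_le)
  define x m where "x = real k0 / real n" and "m = (2 * p + x) / 3"
  have x: "p < x" "x \<le> 1" "k0 \<le> n" and cx: "2 * c * (m * (1 - m)) \<le> real n * (x - p)\<^sup>2"
    using k0 n by (auto simp: x_def m_def)
  have "0 < m * (1 - m)" using p x by (auto simp: m_def)
  then have "c \<le> real n * ((x - p)\<^sup>2 / (2 * (m * (1 - m))))"
    using cx by (simp add: field_simps)
  also have "\<dots> < real n * bernoulli_kl x p"
    unfolding m_def using n p x by (intro mult_strict_left_mono bernoulli_kl_lower_bound) auto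
  finally have "exp (- real n * bernoulli_kl x p) < exp (- c)" by simp
  moreover have "measure_pmf.prob (binomial_pmf n p) ?U
      \<le> measure_pmf.prob (binomial_pmf n p) {k0..}"
    by (intro measure_pmf.finite_measure_mono sub) auto
  moreover have "\<dots> \<le> exp (- real n * bernoulli_kl x p)"
    using n x unfolding x_def by (intro binomial_pmf_chernoff p) auto
  ultimately show ?thesis by linarith
next
  case True
  then show ?thesis by (simp only: measure_empty exp_gt_zero)
qed

lemma binomial_pmf_lower_deviation:
  fixes p c :: real
  assumes p: "0 < p" "p < 1" and n: "0 < n" and c: "0 < c"
  shows "measure_pmf.prob (binomial_pmf n p)
    {k. k \<le> n \<and> real k / real n < p \<and>
        2 * c * ((2 * p + real k / real n) / 3 * (1 - (2 * p + real k / real n) / 3))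
          \<le> real n * (real k / real n - p)\<^sup>2} < exp (- c)"
    (is "measure_pmf.prob _ ?L < _")
proof -
  let ?U = "{k. k \<le> n \<and> 1 - p < real k / real n \<and>
        2 * c * ((2 * (1 - p) + real k / real n) / 3 * (1 - (2 * (1 - p) + real k / real n) / 3))
          \<le> real n * (real k / real n - (1 - p))\<^sup>2}"
  have "k \<in> {k. k \<le> n \<and> n - k \<in> ?L} \<longleftrightarrow> k \<in> ?U" for k
  proof (cases "k \<le> n")
    case True
    define x where "x = real k / real n"
    have nk: "real (n - k) / real n = 1 - x"
      using True n by (simp add: x_def of_nat_diff diff_divide_distrib)
    have "(2 * p + (1 - x)) / 3 * (1 - (2 * p + (1 - x)) / 3)
        = (2 * (1 - p) + x) / 3 * (1 - (2 * (1 - p) + x) / 3)"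
      by (simp add: field_simps)
    moreover have "(1 - x - p)\<^sup>2 = (x - (1 - p))\<^sup>2" by algebra
    ultimately show ?thesis
      using True by (simp only: mem_Collect_eq nk x_def[symmetric]) auto
  qed auto
  then have "{k. k \<le> n \<and> n - k \<in> ?L} = ?U" by blast
  then have "measure_pmf.prob (binomial_pmf n p) ?L = measure_pmf.prob (binomial_pmf n (1 - p)) ?U"
    using p by (subst prob_binomial_pmf_reflect) auto
  also have "\<dots> < exp (- c)"
    using p n c by (intro binomial_pmf_upper_deviation) auto
  finally show ?thesis .
qed

section \<open>The law of the number of successes\<close>

text \<open>
  Each set \<open>J\<close> of trials is the exact set of successes with probability
  \<open>p ^ card J * (1 - p) ^ (n - card J)\<close>; these disjoint events are then grouped by \<open>card J\<close>. A trial
  counts as a failure whenever its value differs from \<open>1\<close>, whatever that value is.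
\<close>

lemma (in prob_space) prob_successes_binomial:
  assumes ind: "indep_vars (\<lambda>_. borel) Y {..<n}"
    and pY: "\<And>i. i < n \<Longrightarrow> prob {\<omega> \<in> space M. Y i \<omega> = 1} = p"
    and p: "p \<in> {0..1}" and n: "0 < n"
  shows "prob {\<omega> \<in> space M. successes Y n \<omega> \<in> A} = measure_pmf.prob (binomial_pmf n p) A"
proof -
  have meas: "Y i \<in> borel_measurable M" if "i < n" for i
    using ind that by (auto simp: indep_vars_def2)
  define E where "E J = (\<Inter>i\<in>{..<n}. Y i -` (if i \<in> J then {1} else - {1}) \<inter> space M)" for J
  have E_iff: "\<omega> \<in> E J \<longleftrightarrow> \<omega> \<in> space M \<and> {i. i < n \<and> Y i \<omega> = 1} = J" if "J \<subseteq> {..<n}" for J \<omega>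
    using that n unfolding E_def by (fastforce split: if_splits)
  have meas_E: "E J \<in> events" for J
    unfolding E_def using n meas by (intro sets.finite_INT) (auto intro!: measurable_sets)
  have prob_E: "prob (E J) = p ^ card J * (1 - p) ^ (n - card J)" if J: "J \<subseteq> {..<n}" for J
  proof -
    have one: "prob (Y i -` (if i \<in> J then {1} else - {1}) \<inter> space M) = (if i \<in> J then p else 1 - p)"
      if i: "i < n" for i
    proof -
      have eq: "Y i -` {1} \<inter> space M = {\<omega> \<in> space M. Y i \<omega> = 1}" by auto
      have ev: "Y i -` {1} \<inter> space M \<in> events"
        using meas[OF i] by (rule measurable_sets) auto
      have "Y i -` (- {1}) \<inter> space M = space M - (Y i -` {1} \<inter> space M)" by auto
      then show ?thesis using prob_compl[OF ev] pY[OF i] eq by simp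
    qed
    have "prob (E J) = (\<Prod>i\<in>{..<n}. prob (Y i -` (if i \<in> J then {1} else - {1}) \<inter> space M))"
      unfolding E_def using n by (intro indep_varsD_finite[OF ind]) auto
    also have "\<dots> = (\<Prod>i\<in>{..<n}. if i \<in> J then p else 1 - p)"
      by (intro prod.cong refl one) auto
    also have "\<dots> = p ^ card J * (1 - p) ^ card ({..<n} - J)"
      using J by (simp add: prod.If_cases Int_absorb1 Diff_eq[symmetric])
    also have "card ({..<n} - J) = n - card J"
      using J by (simp add: card_Diff_subset finite_subset)
    finally show ?thesis .
  qed
  define I where "I = {J. J \<subseteq> {..<n} \<and> card J \<in> A}"
  have fin: "finite I" unfolding I_def by (rule finite_subset[of _ "Pow {..<n}"]) auto
  have "{\<omega> \<in> space M. successes Y n \<omega> \<in> A} = (\<Union>J\<in>I. E J)"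
    by (auto simp: I_def E_iff successes_def)
  also have "prob \<dots> = (\<Sum>J\<in>I. prob (E J))"
  proof (rule finite_measure_finite_Union[OF fin])
    show "disjoint_family_on E I"
      unfolding disjoint_family_on_def using E_iff by (auto simp: I_def)
  qed (use meas_E in auto)
  also have "\<dots> = (\<Sum>J\<in>I. p ^ card J * (1 - p) ^ (n - card J))"
    by (intro sum.cong prob_E) (auto simp: I_def)
  also have "\<dots> = (\<Sum>k\<in>A \<inter> {..n}. \<Sum>J | J \<in> I \<and> card J = k. p ^ card J * (1 - p) ^ (n - card J))"
    using fin card_mono[of "{..<n}"] by (intro sum.group[symmetric]) (auto simp: I_def)
  also have "\<dots> = (\<Sum>k\<in>A \<inter> {..n}. real (n choose k) * p ^ k * (1 - p) ^ (n - k))"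
  proof (intro sum.cong refl)
    fix k assume k: "k \<in> A \<inter> {..n}"
    have "{J. J \<in> I \<and> card J = k} = {J. J \<subseteq> {..<n} \<and> card J = k}"
      using k by (auto simp: I_def)
    then show "(\<Sum>J | J \<in> I \<and> card J = k. p ^ card J * (1 - p) ^ (n - card J))
        = real (n choose k) * p ^ k * (1 - p) ^ (n - k)"
      by (simp add: n_subsets mult.assoc)
  qed
  finally show ?thesis using p by (simp add: measure_binomial_pmf)
qed

section \<open>The confidence limits\<close>

lemma between_limits_if_small_deviation:
  fixes p \<delta> :: real
  assumes N: "0 < N" and k: "k \<le> N" and \<delta>: "0 < \<delta>" "\<delta> < 1"
    and dev: "real N * (real k / real N - p)\<^sup>2
      < 2 * ln (2 / \<delta>) * ((2 * p + real k / real N) / 3 * (1 - (2 * p + real k / real N) / 3))"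
  shows "lower_limit N k \<delta> < p \<and> p < upper_limit N k \<delta>"
proof -
  define x l where "x = real k / real N" and "l = ln (2 / \<delta>)"
  define \<theta> where "\<theta> = theta \<delta>"
  define D R where "D = 1 + \<theta> * real N" and "R = 1 + 4 * \<theta> * real k * (1 - x)"
  have l: "l > 0" using \<delta> by (simp add: l_def)
  have \<theta>: "\<theta> = 9 / (8 * l)" by (simp add: \<theta>_def theta_def l_def)
  have \<theta>_pos: "\<theta> > 0" using l by (simp add: \<theta>)
  have D: "D > 0" unfolding D_def using \<theta>_pos by (intro add_pos_nonneg) auto
  have kx: "real k = real N * x" using N by (simp add: x_def)
  have "4 * \<theta> * (real N * (x - p)\<^sup>2) < 4 * \<theta> * (2 * l * ((2 * p + x) / 3 * (1 - (2 * p + x) / 3)))"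
    using dev \<theta>_pos by (intro mult_strict_left_mono) (auto simp: x_def l_def)
  also have "\<dots> = (4 * \<theta> * (2 * l)) * ((2 * p + x) / 3 * (1 - (2 * p + x) / 3))"
    by (simp only: mult.assoc)
  also have "4 * \<theta> * (2 * l) = 9" using l by (simp add: \<theta>)
  also have "9 * ((2 * p + x) / 3 * (1 - (2 * p + x) / 3)) = (2 * p + x) * (3 - 2 * p - x)"
    by (simp add: field_simps)
  finally have q: "4 * \<theta> * real N * (x - p)\<^sup>2 - (2 * p + x) * (3 - 2 * p - x) < 0" by simp
  \<comment> \<open>Completing the square in \<open>p - x\<close>.\<close>
  have "(4 * D * (p - x) - 3 * (1 - 2 * x))\<^sup>2 - 9 * R
      = 4 * D * (4 * \<theta> * real N * (x - p)\<^sup>2 - (2 * p + x) * (3 - 2 * p - x))"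
    unfolding R_def D_def kx by algebra
  also have "\<dots> < 0" using q D by (intro mult_pos_neg) auto
  finally have "(4 * D * (p - x) - 3 * (1 - 2 * x))\<^sup>2 < 9 * R" by simp
  then have "\<bar>4 * D * (p - x) - 3 * (1 - 2 * x)\<bar> < sqrt (9 * R)"
    by (simp add: real_less_rsqrt)
  then have s: "\<bar>4 * D * (p - x) - 3 * (1 - 2 * x)\<bar> < 3 * sqrt R"
    by (simp add: real_sqrt_mult)
  then have "3 / 4 * ((1 - 2 * x - sqrt R) / D) < p - x"
    "p - x < 3 / 4 * ((1 - 2 * x + sqrt R) / D)"
    using D by (auto simp: field_simps abs_less_iff)
  then show ?thesis
    by (simp add: lower_limit_def upper_limit_def D_def R_def \<theta>_def x_def)
qed

theorem theorem1:
  fixes M :: "'a measure" and Y :: "nat \<Rightarrow> 'a \<Rightarrow> real"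
    and S :: "'b measure" and X :: "'b \<Rightarrow> real"
    and p \<delta> :: real and N :: nat
  assumes "prob_space S" and "bernoulli_rv S X p" and "0 < p" and "p < 1"
    and "prob_space M" and "iid_copies M Y N S X"
    and "N \<ge> 1" and "0 < \<delta>" and "\<delta> < 1"
  shows "measure M {\<omega> \<in> space M.
           lower_limit N (successes Y N \<omega>) \<delta> < p \<and> p < upper_limit N (successes Y N \<omega>) \<delta>}
         > 1 - \<delta>"
proof -
  interpret prob_space M by fact
  have N: "0 < N" using assms by simp
  have ind: "indep_vars (\<lambda>_. borel) Y {..<N}"
    and law: "\<And>i. i < N \<Longrightarrow> distr M borel (Y i) = distr S borel X"
    using assms by (auto simp: iid_copies_def)
  have X: "X \<in> borel_measurable S" "measure S {\<omega> \<in> space S. X \<omega> = 1} = p"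
    using assms by (auto simp: bernoulli_rv_def)
  have pY: "prob {\<omega> \<in> space M. Y i \<omega> = 1} = p" if i: "i < N" for i
  proof -
    have Y: "Y i \<in> borel_measurable M" using ind i by (auto simp: indep_vars_def2)
    have "prob {\<omega> \<in> space M. Y i \<omega> = 1} = measure (distr M borel (Y i)) {1}"
      using Y by (subst measure_distr) (auto intro: arg_cong[where f = prob])
    also have "\<dots> = measure S {\<omega> \<in> space S. X \<omega> = 1}"
      unfolding law[OF i] using X
      by (subst measure_distr) (auto intro: arg_cong[where f = "measure S"])
    finally show ?thesis using X by simp
  qed
  let ?B = "binomial_pmf N p"
  define l where "l = ln (2 / \<delta>)"
  have l: "l > 0" "exp (- l) = \<delta> / 2" using assms by (simp_all add: l_def exp_minus)
  define far where "far k \<longleftrightarrow> 2 * l * ((2 * p + real k / real N) / 3 * (1 - (2 * p + real k / real N) / 3))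
      \<le> real N * (real k / real N - p)\<^sup>2" for k
  define G where "G = {k. lower_limit N k \<delta> < p \<and> p < upper_limit N k \<delta>}"
  define U where "U = {k. k \<le> N \<and> p < real k / real N \<and> far k}"
  define L where "L = {k. k \<le> N \<and> real k / real N < p \<and> far k}"
  have cover: "{..N} \<subseteq> G \<union> (U \<union> L)"
  proof
    fix k assume "k \<in> {..N}"
    then have k: "k \<le> N" by simp
    \<comment> \<open>A count with \<open>real k / real N = p\<close> belongs to neither tail and has to be in \<open>G\<close>.\<close>
    have "\<not> far k" if "real k / real N = p"
      using that l assms by (simp add: far_def not_le)
    moreover have "k \<in> G" if "\<not> far k"
      using that between_limits_if_small_deviation[of N k \<delta> p] N k assms
      by (simp add: far_def G_def l_def not_le)
    ultimately show "k \<in> G \<union> (U \<union> L)"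
      using k by (cases "real k / real N" p rule: linorder_cases) (auto simp: U_def L_def)
  qed
  have "1 = measure_pmf.prob ?B {..N}"
    using assms by (subst eq_commute, subst measure_pmf.prob_eq_1)
      (auto simp: AE_measure_pmf_iff set_pmf_binomial_eq)
  also have "\<dots> \<le> measure_pmf.prob ?B (G \<union> (U \<union> L))"
    using cover by (intro measure_pmf.finite_measure_mono) auto
  also have "\<dots> \<le> measure_pmf.prob ?B G + measure_pmf.prob ?B (U \<union> L)"
    by (rule measure_Un_le) auto
  also have "measure_pmf.prob ?B (U \<union> L) \<le> measure_pmf.prob ?B U + measure_pmf.prob ?B L"
    by (rule measure_Un_le) auto
  finally have "1 \<le> measure_pmf.prob ?B G + (measure_pmf.prob ?B U + measure_pmf.prob ?B L)"
    by simp
  moreover have "measure_pmf.prob ?B U < \<delta> / 2"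
    unfolding U_def far_def l(2)[symmetric] using assms N l
    by (intro binomial_pmf_upper_deviation) auto
  moreover have "measure_pmf.prob ?B L < \<delta> / 2"
    unfolding L_def far_def l(2)[symmetric] using assms N l
    by (intro binomial_pmf_lower_deviation) auto
  moreover have "prob {\<omega> \<in> space M. successes Y N \<omega> \<in> G} = measure_pmf.prob ?B G"
    using assms by (intro prob_successes_binomial ind pY N) auto
  ultimately have "1 - \<delta> < prob {\<omega> \<in> space M. successes Y N \<omega> \<in> G}" by linarith
  then show ?thesis by (simp add: G_def)
qed

end
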